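(* For any finite field $\mathbb{F}_q$ and any fixed $n\ge 3$, the positivity preservers on $M_n(\mathbb{F}_q)$ are precisely the positive multiples of the field automorphisms of $\mathbb{F}_q$, i.e., the functions $f=c\,\sigma$ with $c\in\mathbb{F}_q^+$ and $\sigma$ a field automorphism of $\mathbb{F}_q$.
   Context: $\mathbb{F}_q$ is the finite field with $q$ elements, $\mathbb{F}_q^*=\mathbb{F}_q\setminus\{0\}$, and $\mathbb{F}_q^+:=\{x^2:x\in\mathbb{F}_q^*\}$ is the set of positive elements. $M_n(\mathbb{F}_q)$ is the set of $n\times n$ matrices over $\mathbb{F}_q$. A matrix $A\in M_n(\mathbb{F}_q)$ is positive definite if $A$ is symmetric and all its leading principal minors are non-zero squares in $\mathbb{F}_q$. For $A=(a_{ij})$ and $f:\mathbb{F}_q\to\mathbb{F}_q$, write $f[A]:=(f(a_{ij}))$. The function $f$ is a positivity preserver on $M_n(\mathbb{F}_q)$ if $f[A]$ is positive definite for every positive definite $A\in M_n(\mathbb{F}_q)$. *)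

theory Defs
  imports "Jordan_Normal_Form.Determinant"
begin

text \<open>
  A finite field is a type of class \<open>{field, finite}\<close>.  A field automorphism is the
  \<open>field_isom\<close> of \<open>Polynomial_Interpolation.Ring_Hom\<close> taken from a type to
  itself.
\<close>

definition positive_elements :: "'a :: field set" where
  "positive_elements = {x ^ 2 | x. x \<noteq> 0}"

definition leading_principal_submatrix :: "nat \<Rightarrow> 'a mat \<Rightarrow> 'a mat" where
  "leading_principal_submatrix k A = mat k k (\<lambda>(i, j). A $$ (i, j))"

definition positive_definite :: "nat \<Rightarrow> 'a :: field mat \<Rightarrow> bool" where
  "positive_definite n A \<longleftrightarrow>
     A \<in> carrier_mat n n \<and>
     transpose_mat A = A \<and>
     (\<forall>k \<in> {1..n}. det (leading_principal_submatrix k A) \<in> positive_elements)"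

definition positivity_preserver :: "nat \<Rightarrow> ('a :: field \<Rightarrow> 'a) \<Rightarrow> bool" where
  "positivity_preserver n f \<longleftrightarrow>
     (\<forall>A. positive_definite n A \<longrightarrow> positive_definite n (map_mat f A))"

end

theory Submission
  imports Defs
begin

text \<open>
  Write \<open>P\<close> for the non-zero squares of the finite field.  A positive multiple of an automorphism
  preserves positivity because determinants commute with ring homomorphisms
  (\<open>automorphism_multiple_preserves\<close>).

  For the converse, bordering by an identity block shows that \<open>f\<close> preserves positive definite
  matrices of size 3, that is, the condition \<open>pd3\<close> on six entries
  (\<open>positivity_preserver_pd3\<close>).  Positive scaling does not affect this, so one may assume
  \<open>f 1 = 1\<close>.

  First, \<open>f\<close> is injective (\<open>preserves_pd3_injective\<close>): if \<open>f u = f v\<close> with \<open>u \<noteq> v\<close>, one looks for a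
  positive definite matrix with rows \<open>(s, u, v)\<close>, \<open>(u, t, t)\<close>, \<open>(v, t, t)\<close>, whose determinant is
  \<open>- t * (v - u)\<^sup>2\<close>.  Its image has two equal rows and is singular, a contradiction.  A suitable matrix
  exists with \<open>t = 1\<close> or \<open>t = - 1\<close>, according to whether \<open>- 1\<close> is a square, except in the field with
  five elements; there \<open>f\<close> turns out to be the identity by direct computation.

  Second, injectivity makes inclusions rigid.  If \<open>f\<close> maps the translate \<open>z + P\<close> into \<open>x + P\<close>, then
  it maps it onto \<open>x + P\<close>, and this determines \<open>x\<close>, since \<open>P\<close> is not invariant under any
  non-zero translation (\<open>translate_image_unique\<close>).  If all entries of a matrix
  except the last diagonal one are fixed, with the smaller leading minors in \<open>P\<close>, then positive
  definiteness says exactly that the last entry lies in a certain translate of \<open>P\<close>.  Applied to the matrix with rows \<open>(1, a, b)\<close>, \<open>(a, 1 + a\<^sup>2, e)\<close>,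
  \<open>(b, e, c)\<close>, whose determinant is \<open>c - b\<^sup>2 - (e - a * b)\<^sup>2\<close>, and to the one with \<open>a = 0\<close> and
  \<open>e - a * b\<close> in place of \<open>e\<close>, which yields the same translate, this gives
  \<open>(f (e - a * b))\<^sup>2 = (f e - f a * f b)\<^sup>2\<close> for all \<open>a\<close>, \<open>b\<close>, \<open>e\<close>.

  Finally, an injective solution of this equation with \<open>f 0 = 0\<close> and \<open>f 1 = 1\<close> is additive and
  multiplicative: the signs are forced (\<open>signed_functional_equation\<close>).
\<close>

section \<open>Squares in a finite field\<close>

lemma one_positive: "(1 :: 'a :: field) \<in> positive_elements"
  unfolding positive_elements_def by (intro CollectI exI[of _ 1]) simp

lemma positive_elementsI: "x \<noteq> 0 \<Longrightarrow> x * x \<in> (positive_elements :: 'a :: field set)"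
  unfolding positive_elements_def by (auto simp: power2_eq_square)

lemma positive_elementsE:
  assumes "(p :: 'a :: field) \<in> positive_elements"
  obtains x where "x \<noteq> 0" "p = x * x"
  using assms unfolding positive_elements_def by (auto simp: power2_eq_square)

lemma zero_not_positive: "(0 :: 'a :: field) \<notin> positive_elements"
  by (auto elim: positive_elementsE)

lemma positive_mult:
  assumes "p \<in> positive_elements" "q \<in> positive_elements"
  shows "p * q \<in> (positive_elements :: 'a :: field set)"
proof -
  obtain x y where "x \<noteq> 0" "p = x * x" "y \<noteq> 0" "q = y * y"
    using assms by (metis positive_elementsE)
  then show ?thesis using positive_elementsI[of "x * y"] by (simp add: ac_simps)
qed

lemma positive_inverse:
  assumes "p \<in> positive_elements"
  shows "inverse p \<in> (positive_elements :: 'a :: field set)"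
proof -
  obtain x where "x \<noteq> 0" "p = x * x"
    using assms by (metis positive_elementsE)
  then show ?thesis using positive_elementsI[of "inverse x"] by simp
qed

lemma positive_mult_iff:
  assumes "p \<in> positive_elements"
  shows "p * q \<in> (positive_elements :: 'a :: field set) \<longleftrightarrow> q \<in> positive_elements"
proof
  assume "p * q \<in> positive_elements"
  then have "inverse p * (p * q) \<in> positive_elements"
    using assms positive_inverse positive_mult by blast
  moreover have "p \<noteq> 0" using assms zero_not_positive by metis
  ultimately show "q \<in> positive_elements" by (simp add: mult.assoc[symmetric])
qed (use assms positive_mult in blast)

text \<open>
  Squaring is two-to-one on the non-zero elements, and one-to-one in characteristic 2.
\<close>

lemma card_nonzero_eq:
  "card (UNIV - {0 :: 'a :: {field, finite}}) =
    (if (2 :: 'a) = 0 then 1 else 2) * card (positive_elements :: 'a set)"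
proof -
  let ?U = "UNIV - {0 :: 'a}" and ?k = "if (2 :: 'a) = 0 then 1 else 2 :: nat"
  have P: "positive_elements = (\<lambda>x :: 'a. x * x) ` ?U"
    by (auto elim: positive_elementsE intro: positive_elementsI)
  have fibre: "card {x \<in> ?U. x * x = p} = ?k" if "p \<in> positive_elements" for p
  proof -
    obtain r where r: "r \<noteq> 0" "p = r * r" using \<open>p \<in> positive_elements\<close> by (rule positive_elementsE)
    then have "{x \<in> ?U. x * x = p} = {r, - r}" by (auto simp: square_eq_iff)
    moreover have "r = - r \<longleftrightarrow> (2 :: 'a) = 0"
      using r(1) by (simp add: eq_neg_iff_add_eq_0 mult_2[symmetric])
    moreover have "card {r, s} = (if r = s then 1 else 2)" for s
      by simp
    ultimately show ?thesis by (simp only:)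
  qed
  have "card ?U = (\<Sum>p \<in> positive_elements. card {x \<in> ?U. x * x = p})"
    unfolding card_eq_sum P by (rule sum.image_gen) simp
  also have "\<dots> = (\<Sum>p \<in> (positive_elements :: 'a set). ?k)"
    by (rule sum.cong) (simp_all only: fibre)
  finally show ?thesis by (simp only: sum_constant mult.commute of_nat_id)
qed

text \<open>
  The cardinality of the field vanishes in the field, so that of its non-zero elements is
  \<open>- 1\<close> there; the number of squares divides the latter.
\<close>

lemma of_nat_card_positive_nonzero:
  "of_nat (card (positive_elements :: 'a :: {field, finite} set)) \<noteq> (0 :: 'a)"
proof
  assume *: "of_nat (card (positive_elements :: 'a set)) = (0 :: 'a)"
  have "(\<Sum>x \<in> UNIV. x + (1 :: 'a)) = \<Sum>UNIV"
    by (rule sum.reindex_bij_witness[of _ "\<lambda>x. x - 1" "\<lambda>x. x + 1"]) auto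
  then have "of_nat (card (UNIV :: 'a set)) = (0 :: 'a)" by (simp add: sum.distrib)
  moreover have "card (UNIV :: 'a set) = Suc (card (UNIV - {0 :: 'a}))"
    by (rule card.remove) simp_all
  ultimately show False using * by (simp add: card_nonzero_eq del: card_Diff_insert)
qed

text \<open>
  Sum the elements of both translates: the sums differ by \<open>x - y\<close> times the number of squares,
  which is invertible in the field.
\<close>

lemma translate_positive_inject:
  fixes x y :: "'a :: {field, finite}"
  assumes "(\<lambda>p. x + p) ` positive_elements = (\<lambda>p. y + p) ` positive_elements"
  shows "x = y"
proof -
  have S: "(\<Sum>c \<in> (\<lambda>p. z + p) ` positive_elements. c) =
      of_nat (card (positive_elements :: 'a set)) * z + \<Sum>positive_elements" for z :: 'a
    by (subst sum.reindex) (auto simp: sum.distrib)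
  have "of_nat (card (positive_elements :: 'a set)) * x =
      of_nat (card (positive_elements :: 'a set)) * y"
    using S[of x] S[of y] assms by (metis add_right_cancel)
  then show ?thesis
    by (simp only: mult_cancel_left of_nat_card_positive_nonzero simp_thms)
qed

text \<open>
  This is how equations are extracted from the mere preservation of positivity.  An injective map
  from one translate of the squares into another is onto, so the target is determined by the source.
\<close>

lemma translate_image_unique:
  fixes f :: "'a :: {field, finite} \<Rightarrow> 'a"
  assumes "inj f"
    and "\<And>c. c - z \<in> positive_elements \<Longrightarrow> f c - x \<in> positive_elements"
    and "\<And>c. c - z \<in> positive_elements \<Longrightarrow> f c - y \<in> positive_elements"
  shows "x = y"
proof -
  let ?T = "\<lambda>z. (\<lambda>p. z + p) ` (positive_elements :: 'a set)"
  have mem: "c \<in> ?T z \<longleftrightarrow> c - z \<in> positive_elements" for c z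
    by (metis (no_types, lifting) add.commute add_diff_cancel diff_add_cancel imageE image_eqI)
  have card: "card (?T z) = card (positive_elements :: 'a set)" for z
    by (simp add: card_image)
  have "f ` ?T z = ?T w"
    if "\<And>c. c - z \<in> positive_elements \<Longrightarrow> f c - w \<in> positive_elements" for w
  proof (rule card_subset_eq)
    show "f ` ?T z \<subseteq> ?T w" using that mem by blast
    show "card (f ` ?T z) = card (?T w)"
      using assms(1) by (metis card card_image inj_on_subset subset_UNIV)
  qed simp
  then show ?thesis using assms(2,3) translate_positive_inject[of x y] by metis
qed

text \<open>
  If \<open>- 1\<close> is not a square, the squares and their negatives are disjoint and, by counting, exhaust
  the non-zero elements.
\<close>

lemma negatives_cover_nonsquares:
  fixes x :: "'a :: {field, finite}"
  assumes "(- 1 :: 'a) \<notin> positive_elements" "x \<noteq> 0"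
  shows "x \<in> positive_elements \<or> - x \<in> positive_elements"
proof -
  let ?P = "positive_elements :: 'a set"
  have two: "(2 :: 'a) \<noteq> 0"
    using assms(1) one_positive by (metis add_eq_0_iff one_add_one)
  have "?P \<inter> uminus ` ?P = {}"
  proof -
    have "- p \<notin> ?P" if "p \<in> ?P" for p
      using that assms(1) positive_mult_iff[of p "- 1"] by simp
    then show ?thesis by auto
  qed
  then have "card (?P \<union> uminus ` ?P) = card (UNIV - {0 :: 'a})"
    unfolding card_nonzero_eq using two
    by (simp add: card_Un_disjoint card_image)
  moreover have "?P \<union> uminus ` ?P \<subseteq> UNIV - {0}"
    using zero_not_positive[where 'a = 'a] by auto
  ultimately have "?P \<union> uminus ` ?P = UNIV - {0}" by (intro card_subset_eq) auto
  then have "x \<in> ?P \<union> uminus ` ?P" using assms(2) by auto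
  then show ?thesis by auto
qed

text \<open>
  Otherwise translation by 1 would map the squares to squares, contradicting
  \<open>translate_positive_inject\<close>.
\<close>

lemma nonsquare_successor:
  assumes "(- 1 :: 'a :: {field, finite}) \<notin> positive_elements"
  obtains v :: "'a :: {field, finite}" where "v \<noteq> 0" "- (1 + v * v) \<in> positive_elements"
proof -
  let ?P = "positive_elements :: 'a set"
  have "\<exists>p \<in> ?P. 1 + p \<notin> ?P"
  proof (rule ccontr)
    assume "\<not> ?thesis"
    then have "(\<lambda>p. 1 + p) ` ?P = ?P"
      by (intro card_subset_eq) (auto simp: card_image)
    then have "(1 :: 'a) = 0" by (intro translate_positive_inject) simp
    then show False by simp
  qed
  then obtain v where v: "v \<noteq> 0" "1 + v * v \<notin> ?P" by (metis positive_elementsE)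
  have "1 + v * v \<noteq> 0"
    using assms positive_elementsI[OF v(1)] by (metis add_eq_0_iff)
  then have "- (1 + v * v) \<in> ?P"
    using v(2) negatives_cover_nonsquares[OF assms] by metis
  with v(1) show thesis by (rule that)
qed

text \<open>
  In characteristic 2, \<open>1 + u\<^sup>2 = (1 + u)\<^sup>2\<close>.  In odd characteristic the
  parametrisation \<open>(2 * m, m\<^sup>2 - 1, m\<^sup>2 + 1)\<close> works unless every non-zero \<open>m\<close> satisfies \<open>m ^ 4 = 1\<close>.  With \<open>i\<^sup>2 = - 1\<close> one has \<open>(1 + i) ^ 4 = - 4\<close>, which is different from 1 unless the
  characteristic is 5; in characteristic 5 the only fourth roots of unity are the non-zero elements
  of the prime field.
\<close>

lemma nondegenerate_pythagorean_triple:
  assumes "(- 1 :: 'a :: field) \<in> positive_elements"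
    and "\<exists>u :: 'a :: field. u \<noteq> 0 \<and> u \<noteq> 1"
    and "(5 :: 'a :: field) = 0 \<Longrightarrow> \<exists>m :: 'a. m \<noteq> 0 \<and> m \<noteq> 1 \<and> m \<noteq> - 1 \<and> m \<noteq> 2 \<and> m \<noteq> - 2"
  obtains x y z :: "'a :: field" where "x \<noteq> 0" "y \<noteq> 0" "z \<noteq> 0" "x * x + y * y = z * z"
proof (cases "(2 :: 'a) = 0")
  case True
  obtain u :: 'a where u: "u \<noteq> 0" "u \<noteq> 1" using assms(2) by blast
  have "(1 + u) * (1 + u) = 1 * 1 + u * u + 2 * u" by (simp add: algebra_simps)
  then have "1 * 1 + u * u = (1 + u) * (1 + u)" by (simp add: True)
  moreover have "1 + u \<noteq> 0" using u(2) True by (metis add_left_cancel one_add_one)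
  ultimately show thesis using that u(1) by (metis one_neq_zero)
next
  case False
  have "\<exists>m :: 'a. m \<noteq> 0 \<and> m * m \<noteq> 1 \<and> m * m \<noteq> - 1"
  proof (cases "(5 :: 'a) = 0")
    case True
    then obtain m :: 'a where m: "m \<noteq> 0" "m \<noteq> 1" "m \<noteq> - 1" "m \<noteq> 2" "m \<noteq> - 2"
      using assms(3) by blast
    have "m * m \<noteq> 1 * 1" unfolding square_eq_iff using m by blast
    moreover have "(2 :: 'a) * 2 = - 1" using True by (simp add: eq_neg_iff_add_eq_0)
    then have "m * m \<noteq> - 1" using m square_eq_iff[of m 2] by metis
    ultimately show ?thesis using m(1) by auto
  next
    case five: False
    obtain i :: 'a where i: "i * i = - 1" using assms(1) by (metis positive_elementsE)
    have a: "1 + i \<noteq> 0" using i False by (metis add_eq_0_iff minus_mult_minus mult_1 one_add_one)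
    have sq: "(1 + i) * (1 + i) = 2 * i" using i by (simp add: algebra_simps)
    have four: "(2 * i) * (2 * i) = - 4"
      using i by (simp add: mult.assoc mult.left_commute[of i])
    have "(2 * i) \<noteq> 1"
    proof
      assume "2 * i = 1"
      then show False using four five by (simp add: eq_neg_iff_add_eq_0)
    qed
    moreover have "(2 * i) \<noteq> - 1"
    proof
      assume "2 * i = - 1"
      then have "(- 1) * (- 1) = (- 4 :: 'a)" using four by (simp only:)
      then show False using five by (simp add: eq_neg_iff_add_eq_0)
    qed
    ultimately show ?thesis using a sq by metis
  qed
  then obtain m :: 'a where m: "m \<noteq> 0" "m * m \<noteq> 1" "m * m \<noteq> - 1" by blast
  show thesis
  proof (rule that)
    show "2 * m \<noteq> 0" using m False by simp
    show "m * m - 1 \<noteq> 0" "m * m + 1 \<noteq> 0" using m by (auto simp: add_eq_0_iff2)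
    show "2 * m * (2 * m) + (m * m - 1) * (m * m - 1) = (m * m + 1) * (m * m + 1)"
      by (simp add: algebra_simps)
  qed
qed

section \<open>Reduction to matrices of size three\<close>

lemma det_2x2:
  "det (mat 2 2 g) = g (0, 0) * g (1, 1) - g (0, 1) * (g (1, 0) :: 'a :: comm_ring_1)"
proof -
  have "{..<2::nat} = {0, 1}" by auto
  then show ?thesis
    by (simp add: laplace_expansion_row[of "mat 2 2 g" 2 0] cofactor_def mat_delete_def
      det_single algebra_simps)
qed

lemma det_3x3:
  fixes g :: "nat \<times> nat \<Rightarrow> 'a :: comm_ring_1"
  shows "det (mat 3 3 g) =
    g (0, 0) * (g (1, 1) * g (2, 2) - g (1, 2) * g (2, 1))
    - g (0, 1) * (g (1, 0) * g (2, 2) - g (1, 2) * g (2, 0))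
    + g (0, 2) * (g (1, 0) * g (2, 1) - g (1, 1) * g (2, 0))"
proof -
  have e: "{..<3::nat} = {0, 1, 2}" by auto
  show ?thesis
    by (simp add: laplace_expansion_row[of "mat 3 3 g" 3 0] e cofactor_def mat_delete_def
      det_2x2 numeral_2_eq_2[symmetric] algebra_simps)
qed

text \<open>
  Positive definiteness of the symmetric matrix with rows \<open>(a, b, c)\<close>, \<open>(b, d, e)\<close>, \<open>(c, e, g)\<close>,
  with its minors written out.
\<close>

definition pd3 :: "'a :: field \<Rightarrow> 'a \<Rightarrow> 'a \<Rightarrow> 'a \<Rightarrow> 'a \<Rightarrow> 'a \<Rightarrow> bool" where
  "pd3 a b c d e g \<longleftrightarrow>
     a \<in> positive_elements \<and>
     a * d - b * b \<in> positive_elements \<and>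
     a * (d * g - e * e) - b * (b * g - e * c) + c * (b * e - d * c) \<in> positive_elements"

definition sym3 :: "'a \<Rightarrow> 'a \<Rightarrow> 'a \<Rightarrow> 'a \<Rightarrow> 'a \<Rightarrow> 'a \<Rightarrow> nat \<times> nat \<Rightarrow> 'a" where
  "sym3 a b c d e g =
     (\<lambda>(i, j). [[a, b, c], [b, d, e], [c, e, g]] ! i ! j)"

lemma leading_minors_upto_3:
  assumes "3 \<le> n" "A \<in> carrier_mat n n"
    "\<And>i j. i < 3 \<Longrightarrow> j < 3 \<Longrightarrow> A $$ (i, j) = sym3 a b c d e g (i, j)"
  shows "pd3 a b c d e g \<longleftrightarrow>
    (\<forall>k \<in> {1..3}. det (leading_principal_submatrix k A) \<in> positive_elements)"
proof -
  have k: "{1..3::nat} = {1, 2, 3}" by auto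
  have "det (leading_principal_submatrix 1 A) = a"
    using assms(3)[of 0 0]
    by (simp add: leading_principal_submatrix_def det_single sym3_def)
  moreover have "det (leading_principal_submatrix 2 A) = a * d - b * b"
    by (simp add: leading_principal_submatrix_def det_2x2 assms(3) sym3_def)
  moreover have "det (leading_principal_submatrix 3 A) =
      a * (d * g - e * e) - b * (b * g - e * c) + c * (b * e - d * c)"
    by (simp add: leading_principal_submatrix_def det_3x3 assms(3) sym3_def)
  ultimately show ?thesis unfolding k pd3_def by simp
qed

lemma positive_definite_extend_by_identity:
  assumes "3 \<le> n" "pd3 a b c d e g"
  defines "A \<equiv> mat n n (\<lambda>(i, j).
    if i < 3 \<and> j < 3 then sym3 a b c d e g (i, j) else if i = j then 1 else 0)"
  shows "positive_definite n A"
proof -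
  have minors: "\<forall>k \<in> {1..3}. det (leading_principal_submatrix k A) \<in> positive_elements"
    using assms by (subst leading_minors_upto_3[symmetric, of n _ a b c d e g]) auto
  have "det (leading_principal_submatrix k A) \<in> positive_elements" if k: "k \<in> {1..n}" for k
  proof (cases "k \<le> 3")
    case True
    then show ?thesis using minors k by auto
  next
    case False
    define B where "B = leading_principal_submatrix 3 A"
    have "leading_principal_submatrix k A =
        four_block_mat B (0\<^sub>m 3 (k - 3)) (0\<^sub>m (k - 3) 3) (1\<^sub>m (k - 3))"
      using False k assms(1)
      by (intro eq_matI) (auto simp: B_def A_def leading_principal_submatrix_def)
    then have "det (leading_principal_submatrix k A) = det B"
      by (simp add: det_four_block_mat_lower_left_zero[of _ 3 _ "k - 3"]
          B_def leading_principal_submatrix_def)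
    then show ?thesis using minors by (simp add: B_def)
  qed
  moreover have "sym3 a b c d e g (i, j) = sym3 a b c d e g (j, i)" if "i < 3" "j < 3" for i j
    using that by (auto simp: sym3_def less_Suc_eq numeral_3_eq_3)
  then have "transpose_mat A = A"
    by (intro eq_matI) (auto simp: A_def)
  ultimately show ?thesis by (auto simp: positive_definite_def A_def)
qed

lemma positivity_preserver_pd3:
  assumes "3 \<le> n" "positivity_preserver n f" "pd3 a b c d e g"
  shows "pd3 (f a) (f b) (f c) (f d) (f e) (f g)"
proof -
  define A where "A = mat n n (\<lambda>(i, j).
    if i < 3 \<and> j < 3 then sym3 a b c d e g (i, j) else if i = j then 1 else 0)"
  have "positive_definite n (map_mat f A)"
    using assms positive_definite_extend_by_identity[OF assms(1,3)]
    by (simp add: positivity_preserver_def A_def)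
  moreover have "map_mat f A $$ (i, j) = sym3 (f a) (f b) (f c) (f d) (f e) (f g) (i, j)"
    if "i < 3" "j < 3" for i j
    using that assms(1) by (auto simp: A_def sym3_def less_Suc_eq numeral_3_eq_3)
  ultimately show ?thesis
    using assms(1) leading_minors_upto_3[of n "map_mat f A"]
    by (auto simp: positive_definite_def)
qed

definition preserves_pd3 :: "('a :: field \<Rightarrow> 'a) \<Rightarrow> bool" where
  "preserves_pd3 f \<longleftrightarrow>
     (\<forall>a b c d e g. pd3 a b c d e g \<longrightarrow> pd3 (f a) (f b) (f c) (f d) (f e) (f g))"

text \<open>
  The assumptions say that the matrix with rows \<open>(s, u, v)\<close>, \<open>(u, t, t)\<close>, \<open>(v, t, t)\<close> is positive
  definite.  If \<open>f u = f v\<close>, the last two rows of its image coincide.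
\<close>

lemma separates_if_pd3:
  assumes "preserves_pd3 f" "s \<in> positive_elements" "s * t - u * u \<in> positive_elements"
    "- t * ((v - u) * (v - u)) \<in> positive_elements"
  shows "f u \<noteq> f v"
proof
  assume eq: "f u = f v"
  have "s * (t * t - t * t) - u * (u * t - t * v) + v * (u * t - t * v) =
      - t * ((v - u) * (v - u))"
    by (simp add: algebra_simps)
  then have "pd3 s u v t t t" using assms by (simp add: pd3_def)
  then have "pd3 (f s) (f u) (f v) (f t) (f t) (f t)"
    using assms(1) unfolding preserves_pd3_def by blast
  then show False
    using eq zero_not_positive[where 'a = 'a] by (simp add: pd3_def mult.commute)
qed

text \<open>
  A matrix of size 2 is bordered by a single 1.  After applying \<open>f\<close> the border need not stay
  trivial, but the first two minors are unaffected.
\<close>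

lemma diagonal_pair_pd3:
  "pd3 a b 0 c 0 1 \<longleftrightarrow> a \<in> positive_elements \<and> a * c - b * b \<in> positive_elements"
  by (auto simp: pd3_def mult.assoc)

lemma preserves_pd3_minors:
  assumes "preserves_pd3 f" "a \<in> positive_elements"
    "a * c - b * b \<in> positive_elements"
  shows "f a \<in> positive_elements" "f a * f c - f b * f b \<in> positive_elements"
proof -
  have "pd3 (f a) (f b) (f 0) (f c) (f 0) (f 1)"
    using assms unfolding preserves_pd3_def by (simp add: diagonal_pair_pd3)
  then show "f a \<in> positive_elements" "f a * f c - f b * f b \<in> positive_elements"
    by (simp_all add: pd3_def)
qed

section \<open>Injectivity\<close>

text \<open>
  Here the type is the field with five elements; its elements are listed as \<open>0\<close>, \<open>1\<close>, \<open>- 1\<close>, \<open>2\<close>,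
  \<open>- 2\<close> because this makes the squares visible as the first two non-zero ones.
\<close>

lemma positive_elements_prime_field_5:
  assumes "(5 :: 'a :: field) = 0" "\<And>x :: 'a. x \<in> {0, 1, - 1, 2, - 2}"
  shows "(2 :: 'a) \<noteq> 0" "positive_elements = {1, - 1 :: 'a}"
proof -
  show two: "(2 :: 'a) \<noteq> 0"
  proof
    assume "(2 :: 'a) = 0"
    moreover have "(5 :: 'a) = 2 * 2 + 1" by simp
    ultimately show False using assms(1) by simp
  qed
  have "(2 :: 'a) * 2 = - 1" using assms(1) by (simp add: eq_neg_iff_add_eq_0)
  then have "x \<noteq> 0 \<Longrightarrow> x * x \<in> {1, - 1}" for x :: 'a
    using assms(2)[of x] by auto
  moreover have "- 1 \<in> (positive_elements :: 'a set)"
    using \<open>2 * 2 = - 1\<close> two positive_elementsI[of "2 :: 'a"] by metis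
  moreover note one_positive[where 'a = 'a]
  ultimately show "positive_elements = {1, - 1 :: 'a}"
    by (intro equalityI subsetI) (metis positive_elementsE, blast)
qed

text \<open>
  In the field with five elements, no two non-zero squares sum to a non-zero square, so the
  argument for injectivity only separates 0 from the rest.  But then four matrices of size 2, with
  diagonals \<open>(1, 1)\<close>, \<open>(1, 2)\<close>, \<open>(1, - 2)\<close>, \<open>(- 1, - 2)\<close>, determine all values one after the
  other.
\<close>

lemma identity_on_prime_field_5:
  fixes f :: "'a :: field \<Rightarrow> 'a"
  assumes "preserves_pd3 f" "f 1 = 1" "\<And>u. u \<noteq> 0 \<Longrightarrow> f u \<noteq> f 0"
    and five: "(5 :: 'a) = 0" and elems: "\<And>x :: 'a. x \<in> {0, 1, - 1, 2, - 2}"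
  shows "f x = x"
proof -
  note two = positive_elements_prime_field_5(1)[OF five elems]
  note P = positive_elements_prime_field_5(2)[OF five elems]
  have four: "(4 :: 'a) = - 1" using five by (simp add: eq_neg_iff_add_eq_0)
  have three: "(3 :: 'a) = - 2" using five by (simp add: eq_neg_iff_add_eq_0)
  note minors = preserves_pd3_minors[OF assms(1)]
  have neq: "(2 :: 'a) \<noteq> 1" "(2 :: 'a) \<noteq> - 1"
  proof -
    show "(2 :: 'a) \<noteq> 1" by (metis add_cancel_right_right one_add_one zero_neq_one)
    show "(2 :: 'a) \<noteq> - 1"
      using two by (simp only: eq_neg_iff_add_eq_0) (simp add: three)
  qed
  have "f 1 * f 1 - f 0 * f 0 \<in> positive_elements"
    using minors(2)[of 1 1 0] by (simp add: P)
  moreover have "f 0 * f 0 \<in> {0, 1, - 1}"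
    using elems[of "f 0"] by (auto simp: four)
  ultimately have f0: "f 0 = 0"
    using assms(3)[of 1] neq by (auto simp: P assms(2))
  have "f 1 * f 2 - f 1 * f 1 \<in> positive_elements"
    using minors(2)[of 1 2 1] by (simp add: P)
  then have f2: "f 2 = 2"
    using assms(3)[of 2] f0 two by (auto simp: P assms(2) diff_eq_eq)
  have "1 + (5 :: 'a) = 1" by (simp only: five add_0_right)
  then have "(6 :: 'a) = 1" by simp
  then have "f 1 * f (- 2) - f 2 * f 2 \<in> positive_elements"
    using minors(2)[of 1 "- 2" 2] by (simp add: P)
  then have fm2: "f (- 2) = - 2"
    using assms(3)[of "- 2"] f0 two
    by (auto simp: P assms(2) f2 diff_eq_eq four three eq_neg_iff_add_eq_0 add.commute)
  have "f (- 1) \<in> positive_elements" "f (- 1) * f (- 2) - f 1 * f 1 \<in> positive_elements"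
    using minors[of "- 1" "- 2" 1] by (simp_all add: P)
  moreover have "(4 :: 'a) \<noteq> 0" by (simp add: four)
  ultimately have "f (- 1) = - 1"
    using neq by (auto simp: P assms(2) fm2 three)
  then show ?thesis using elems[of x] f0 f2 fm2 assms(2) by auto
qed

text \<open>
  As \<open>u\<close> and \<open>v\<close> are interchangeable, it suffices to find a matrix for \<open>separates_if_pd3\<close> whenever
  \<open>u \<noteq> v\<close> and \<open>u \<noteq> 0\<close>.  If \<open>- 1\<close> is a square this requires a Pythagorean triple; the fields with two
  and five elements, which have none, fall back on \<open>u = 0\<close> and \<open>s = t = 1\<close>.
\<close>

lemma preserves_pd3_injective:
  fixes f :: "'a :: {field, finite} \<Rightarrow> 'a"
  assumes f: "preserves_pd3 f" and f1: "f 1 = 1"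
  shows "inj f"
proof (cases "(- 1 :: 'a) \<in> positive_elements")
  case False
  have sep: "f u \<noteq> f v" if "u \<noteq> v" "u \<noteq> 0" for u v
  proof -
    \<comment> \<open>With \<open>t = - 1\<close> and \<open>s = (u * r)\<^sup>2\<close> the minor of size 2 is \<open>- u\<^sup>2 * (1 + r\<^sup>2)\<close>.\<close>
    obtain r :: 'a where r: "r \<noteq> 0" "- (1 + r * r) \<in> positive_elements"
      using nonsquare_successor[OF False] by blast
    have "u * u * - (1 + r * r) \<in> positive_elements"
      using r(2) that(2) by (intro positive_mult positive_elementsI)
    moreover have "u * u * - (1 + r * r) = (u * r) * (u * r) * - 1 - u * u"
      by (simp add: algebra_simps)
    moreover have "(u * r) * (u * r) \<in> positive_elements"
      using r(1) that(2) by (intro positive_elementsI) simp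
    ultimately show ?thesis
      using that(1) separates_if_pd3[OF f, of "(u * r) * (u * r)" "- 1" u v]
        positive_elementsI[of "v - u"] by simp
  qed
  show ?thesis by (rule injI) (metis sep)
next
  case True
  \<comment> \<open>Here \<open>t = 1\<close>: the determinant \<open>- (v - u)\<^sup>2\<close> is a square.\<close>
  have sep: "f u \<noteq> f v"
    if "u \<noteq> v" "s \<in> positive_elements" "s - u * u \<in> positive_elements" for u v s
    using that True separates_if_pd3[OF f, of s 1 u v]
      positive_mult[OF True positive_elementsI[of "v - u"]] by simp
  have sep0: "f u \<noteq> f 0" if "u \<noteq> 0" for u
    using sep[of 0 u 1] that one_positive by auto
  show ?thesis
  proof (cases "\<exists>x y z :: 'a. x \<noteq> 0 \<and> y \<noteq> 0 \<and> z \<noteq> 0 \<and> x * x + y * y = z * z")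
    case triple: True
    then obtain x y z :: 'a where
      xyz: "x \<noteq> 0" "y \<noteq> 0" "z \<noteq> 0" "x * x + y * y = z * z" by blast
    have "f u \<noteq> f v" if "u \<noteq> v" "u \<noteq> 0" for u v
    proof (rule sep[OF that(1)])
      \<comment> \<open>The Pythagorean triple, scaled to have the leg \<open>u\<close>, provides \<open>s\<close>.\<close>
      define k where "k = u / x"
      have k: "k \<noteq> 0" "u = k * x" using xyz that by (auto simp: k_def)
      show "(k * z) * (k * z) \<in> positive_elements"
        using k xyz by (intro positive_elementsI) simp
      have "(k * z) * (k * z) - u * u = k * k * (z * z - x * x)"
        by (simp add: k(2) algebra_simps)
      also have "\<dots> = (k * y) * (k * y)" by (simp add: xyz(4)[symmetric])
      also have "\<dots> \<in> positive_elements" using k xyz by (intro positive_elementsI) simp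
      finally show "(k * z) * (k * z) - u * u \<in> positive_elements" .
    qed
    then show ?thesis by (intro injI) metis
  next
    case no_triple: False
    show ?thesis
    proof (cases "\<exists>u :: 'a. u \<noteq> 0 \<and> u \<noteq> 1")
      case False
      then show ?thesis using sep0 by (intro injI) metis
    next
      case big: True
      \<comment> \<open>The failure of the Pythagorean triples identifies the field with five elements.\<close>
      have "(5 :: 'a) = 0 \<and> (\<forall>x :: 'a. x \<in> {0, 1, - 1, 2, - 2})"
      proof (rule ccontr)
        assume "\<not> ?thesis"
        then have "(5 :: 'a) = 0 \<Longrightarrow> \<exists>m :: 'a. m \<noteq> 0 \<and> m \<noteq> 1 \<and> m \<noteq> - 1 \<and> m \<noteq> 2 \<and> m \<noteq> - 2"
          by blast
        then show False
          using nondegenerate_pythagorean_triple[OF True big] no_triple by metis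
      qed
      then have "f x = x" for x
        using identity_on_prime_field_5[OF f f1 sep0] by blast
      then show ?thesis by (simp add: inj_on_def)
    qed
  qed
qed

section \<open>From injectivity to a field automorphism\<close>

text \<open>
  The equation determines \<open>f (e - a * b)\<close> up to sign.  If the sign is negative for \<open>f (x + y)\<close>,
  then \<open>f (x + (x + y))\<close> equals \<open>f x - (f x + f y)\<close> up to sign, hence \<open>f y\<close> or \<open>f (- y)\<close>; by injectivity
  this only happens in cases where the sign does not matter.  A negative sign for products would, by
  additivity, force \<open>2 * f e\<close> to be the same for all \<open>e\<close>.
\<close>

lemma signed_functional_equation:
  fixes f :: "'a :: field \<Rightarrow> 'a"
  assumes eq: "\<And>e a b. (f (e - a * b))\<^sup>2 = (f e - f a * f b)\<^sup>2"
    and f0: "f 0 = 0" and f1: "f 1 = 1" and "inj f"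
  shows "f (x + y) = f x + f y" "f (x * y) = f x * f y"
proof -
  have sign: "f (e - a * b) = f e - f a * f b \<or> f (e - a * b) = - (f e - f a * f b)" for e a b
    using eq[of e a b] by (simp add: power2_eq_iff)
  have inj: "f u = f v \<Longrightarrow> u = v" for u v using assms(4) by (simp add: inj_eq)
  have odd: "f (- u) = - f u" for u
  proof (cases "f (- u) = f u")
    case True
    then have "- u = u" by (rule inj)
    then have "2 * u = 0" by (metis add_eq_0_iff mult_2)
    then have "(2 :: 'a) = 0 \<or> u = 0" by simp
    then show ?thesis
    proof
      assume "(2 :: 'a) = 0"
      then have "- f u = f u" by (metis add_eq_0_iff mult_2 mult_zero_left)
      then show ?thesis using True by simp
    qed (simp add: f0)
  qed (use sign[of 0 1 u] in \<open>auto simp: f0 f1\<close>)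
  have sum: "f (u + v) = f u + f v \<or> f (u + v) = - (f u + f v)" for u v
    using sign[of u 1 "- v"] by (simp add: f1 odd)
  show add: "f (x + y) = f x + f y" for x y
  proof (rule ccontr)
    assume ne: "f (x + y) \<noteq> f x + f y"
    then have s: "f (x + y) = - (f x + f y)" using sum by blast
    then have "f (x + (x + y)) = f (- y) \<or> f (x + (x + y)) = f y"
      using sum[of x "x + y"] by (auto simp: odd)
    then have "x + (x + y) = - y \<or> x = 0 \<or> x + x + y = y"
      using inj by (metis add.assoc)
    then have "2 * (x + y) = 0 \<or> 2 * x = 0" by (auto simp: algebra_simps eq_neg_iff_add_eq_0)
    then have "x + y = 0 \<or> x = 0 \<or> (2 :: 'a) = 0" by (metis mult_eq_0_iff)
    then show False
    proof (elim disjE)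
      assume "x + y = 0"
      then have "y = - x" by (simp add: add_eq_0_iff)
      then show False using ne by (simp add: odd f0)
    next
      assume "x = 0" then show False using ne by (simp add: f0)
    next
      assume "(2 :: 'a) = 0"
      then have "- w = w" for w :: 'a by (metis add_eq_0_iff mult_2 mult_zero_left)
      then show False using s ne by metis
    qed
  qed
  show "f (x * y) = f x * f y"
  proof (rule ccontr)
    assume ne: "f (x * y) \<noteq> f x * f y"
    have diff: "f (e - x * y) = f e - f (x * y)" for e
      using add[of e "- (x * y)"] by (simp add: odd)
    have "2 * f e = f (x * y) + f x * f y" for e
      using sign[of e x y] ne by (auto simp: diff algebra_simps)
    from this[of 0] this[of 1] have "(2 :: 'a) = 0" "f (x * y) = - (f x * f y)"
      by (auto simp: f0 f1 eq_neg_iff_add_eq_0)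
    then show False using ne by (metis add_eq_0_iff mult_2 mult_zero_left)
  qed
qed

text \<open>
  The translate lemma is applied to the last diagonal entry \<open>c\<close> of a bordered matrix.  The entry
  \<open>1 + a\<^sup>2\<close> makes the second minor equal to 1, and \<open>\<delta> a\<close> is the corresponding minor of the image;
  that it equals 1 is itself a consequence of the resulting equation.
\<close>

lemma unital_preserver_additive_multiplicative:
  fixes f :: "'a :: {field, finite} \<Rightarrow> 'a"
  assumes f: "preserves_pd3 f" and f1: "f 1 = 1"
  shows "f 0 = 0" "f (x + y) = f x + f y" "f (x * y) = f x * f y"
proof -
  let ?P = "positive_elements :: 'a set"
  have inj: "inj f" by (rule preserves_pd3_injective[OF f f1])
  note minors = preserves_pd3_minors[OF f]
  have "f 0 * f 0 = 0"
  proof (rule translate_image_unique[OF inj])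
    show "f c - f 0 * f 0 \<in> ?P" if "c - 0 \<in> ?P" for c
      using minors(2)[of 1 c 0] that one_positive by (simp add: f1)
    show "f c - 0 \<in> ?P" if "c - 0 \<in> ?P" for c
      using minors(1)[of c 1 0] that by simp
  qed
  then show f0: "f 0 = 0" by simp
  define \<delta> where "\<delta> a = f (1 + a * a) - f a * f a" for a
  have bordered: "\<delta> a \<in> ?P"
      "f c - (f b * f b + (f e - f a * f b)\<^sup>2 / \<delta> a) \<in> ?P"
    if c: "c - (b * b + (e - a * b)\<^sup>2) \<in> ?P" for a b c e
  proof -
    have "pd3 1 a b (1 + a * a) e c"
      using c one_positive by (simp add: pd3_def power2_eq_square algebra_simps)
    then have pd: "pd3 1 (f a) (f b) (f (1 + a * a)) (f e) (f c)"
      using f f1 unfolding preserves_pd3_def by metis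
    then show D: "\<delta> a \<in> ?P" by (simp add: pd3_def \<delta>_def)
    then have D0: "\<delta> a \<noteq> 0" using zero_not_positive by metis
    have "\<delta> a * (f c - (f b * f b + (f e - f a * f b)\<^sup>2 / \<delta> a)) =
        \<delta> a * (f c - f b * f b) - (f e - f a * f b)\<^sup>2"
      using D0 by (simp add: algebra_simps)
    also have "\<dots> \<in> ?P"
      using pd by (simp add: pd3_def \<delta>_def power2_eq_square algebra_simps)
    finally show "f c - (f b * f b + (f e - f a * f b)\<^sup>2 / \<delta> a) \<in> ?P"
      using D positive_mult_iff by blast
  qed
  have \<delta>0: "\<delta> 0 = 1" by (simp add: \<delta>_def f0 f1)
  have *: "(f (e - a * b))\<^sup>2 = (f e - f a * f b)\<^sup>2 / \<delta> a" for e a b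
  proof -
    have "f b * f b + (f (e - a * b))\<^sup>2 = f b * f b + (f e - f a * f b)\<^sup>2 / \<delta> a"
    proof (rule translate_image_unique[OF inj])
      \<comment> \<open>The same translate arises from the parameters \<open>(0, b, e - a * b)\<close> and \<open>(a, b, e)\<close>.\<close>
      fix c assume c: "c - (b * b + (e - a * b)\<^sup>2) \<in> ?P"
      show "f c - (f b * f b + (f (e - a * b))\<^sup>2) \<in> ?P"
        using bordered(2)[of c b "e - a * b" 0] c by (simp add: \<delta>0 f0)
      show "f c - (f b * f b + (f e - f a * f b)\<^sup>2 / \<delta> a) \<in> ?P"
        by (rule bordered(2)[OF c])
    qed
    then show ?thesis by simp
  qed
  have "\<delta> a = 1" for a
    using *[of 1 a 0] by (simp add: f0 f1 divide_eq_eq split: if_splits)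
  then have "(f (e - a * b))\<^sup>2 = (f e - f a * f b)\<^sup>2" for e a b
    using * by simp
  from signed_functional_equation[OF this f0 f1 inj]
  show "f (x + y) = f x + f y" "f (x * y) = f x * f y" by blast+
qed

lemma preserves_pd3_scale:
  assumes "preserves_pd3 f" "k \<in> positive_elements"
  shows "preserves_pd3 (\<lambda>x. k * f x)"
proof -
  have "pd3 (k * a) (k * b) (k * c) (k * d) (k * e) (k * g)" if "pd3 a b c d e g" for a b c d e g
  proof -
    have "k * a * (k * d) - k * b * (k * b) = k * (k * (a * d - b * b))"
      "k * a * (k * d * (k * g) - k * e * (k * e)) - k * b * (k * b * (k * g) - k * e * (k * c)) +
        k * c * (k * b * (k * e) - k * d * (k * c)) =
        k * (k * (k * (a * (d * g - e * e) - b * (b * g - e * c) + c * (b * e - d * c))))"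
      by (simp_all add: algebra_simps)
    then show ?thesis using that by (simp only: pd3_def positive_mult_iff[OF assms(2)])
  qed
  then show ?thesis using assms(1) unfolding preserves_pd3_def by blast
qed

section \<open>Classification\<close>

lemma automorphism_multiple_preserves:
  fixes \<sigma> :: "'a :: field \<Rightarrow> 'a"
  assumes "field_hom \<sigma>" "c \<in> positive_elements"
  shows "positivity_preserver n (\<lambda>x. c * \<sigma> x)"
  unfolding positivity_preserver_def
proof (intro allI impI)
  interpret field_hom \<sigma> by fact
  fix A :: "'a mat" assume A: "positive_definite n A"
  let ?A = "map_mat (\<lambda>x. c * \<sigma> x) A"
  have carrier: "A \<in> carrier_mat n n" "transpose_mat A = A"
    using A by (auto simp: positive_definite_def)
  have "det (leading_principal_submatrix k ?A) \<in> positive_elements" if k: "k \<in> {1..n}" for k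
  proof -
    have "leading_principal_submatrix k ?A = c \<cdot>\<^sub>m map_mat \<sigma> (leading_principal_submatrix k A)"
      using carrier k by (intro eq_matI) (auto simp: leading_principal_submatrix_def)
    then have eq: "det (leading_principal_submatrix k ?A) =
        c ^ k * \<sigma> (det (leading_principal_submatrix k A))"
      by (simp add: leading_principal_submatrix_def)
    have "det (leading_principal_submatrix k A) \<in> positive_elements"
      using A k by (simp add: positive_definite_def)
    then obtain x y
      where "x \<noteq> 0" "c = x\<^sup>2" "y \<noteq> 0" "det (leading_principal_submatrix k A) = y\<^sup>2"
      using assms(2) unfolding positive_elements_def by blast
    then have "det (leading_principal_submatrix k ?A) = (x ^ k * \<sigma> y)\<^sup>2" "x ^ k * \<sigma> y \<noteq> 0"
      unfolding eq by (auto simp: hom_power power_mult_distrib power_mult[symmetric] mult.commute)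
    then show ?thesis unfolding positive_elements_def by blast
  qed
  moreover have "transpose_mat ?A = ?A" using carrier by (metis map_mat_transpose)
  ultimately show "positive_definite n ?A" using carrier by (auto simp: positive_definite_def)
qed

theorem corollary1p4:
  fixes n :: nat and f :: "'a :: {field, finite} \<Rightarrow> 'a"
  assumes "n \<ge> 3"
  shows "positivity_preserver n f \<longleftrightarrow>
    (\<exists>c \<in> positive_elements. \<exists>\<sigma> :: 'a \<Rightarrow> 'a. field_isom \<sigma> \<and> f = (\<lambda>x. c * \<sigma> x))"
proof
  assume "positivity_preserver n f"
  then have f: "preserves_pd3 f"
    unfolding preserves_pd3_def using positivity_preserver_pd3[OF assms] by blast
  have c: "f 1 \<in> positive_elements"
    using preserves_pd3_minors(1)[OF f, of 1 1 0] one_positive by simp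
  then have c0: "f 1 \<noteq> 0" using zero_not_positive by metis
  define \<sigma> where "\<sigma> x = inverse (f 1) * f x" for x
  have \<sigma>: "preserves_pd3 \<sigma>" "\<sigma> 1 = 1"
    unfolding \<sigma>_def using preserves_pd3_scale[OF f positive_inverse[OF c]] c0 by simp_all
  note hom = unital_preserver_additive_multiplicative[OF \<sigma>]
  have "surj \<sigma>" using preserves_pd3_injective[OF \<sigma>] by (simp add: finite_UNIV_inj_surj)
  then have "field_isom \<sigma>"
    by unfold_locales (simp_all add: hom \<sigma>(2))
  moreover have "f = (\<lambda>x. f 1 * \<sigma> x)" using c0 by (simp add: \<sigma>_def fun_eq_iff)
  ultimately show "\<exists>c \<in> positive_elements. \<exists>\<sigma>. field_isom \<sigma> \<and> f = (\<lambda>x. c * \<sigma> x)"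
    using c by blast
next
  assume "\<exists>c \<in> positive_elements. \<exists>\<sigma>. field_isom \<sigma> \<and> f = (\<lambda>x. c * \<sigma> x)"
  then show "positivity_preserver n f"
    using automorphism_multiple_preserves field_isom.axioms(1) by blast
qed

end
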